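(* Let $(\mathcal{L}_n)_{n\ge 0}$ be a Lucas-type sequence with data $p_0,p_1,d,g,\alpha$ (as defined in the context) such that $\deg(d)=1$ and $g$ is a constant. Let $\beta=\mathrm{lc}(d)$, $\rho=\mathrm{Res}(g,d)$, and let $d'$ be the derivative of $d$. Then for every integer $n\ge 1$, $$\mathrm{Disc}(\mathcal{L}_n)=(-\rho)^{n(n-1)/2}\,2^{n-1}\,(n d')^{n}\,\alpha^{2-2n}\,\beta^{n(n-2)}.$$
   Context: A Lucas-type sequence is given by a constant $p_0$ with $|p_0|\in\{1,2\}$, the integer $\alpha=2/p_0$, and non-zero polynomials $p_1,d,g\in\mathbb{Q}[x]$ with $d=\alpha p_1$, via $\mathcal{L}_0=p_0$, $\mathcal{L}_1=p_1$, $\mathcal{L}_n=d\,\mathcal{L}_{n-1}+g\,\mathcal{L}_{n-2}$ for $n\ge 2$. Standing assumptions: $\gcd(d,g)=1$, $\deg(g)<\deg(d)$, $\gcd(p_0,p_1)=\gcd(p_0,d)=\gcd(p_0,g)=1$, and $\deg(\mathcal{L}_1)\ge 1$. $\mathrm{lc}(P)$ denotes the leading coefficient of $P$. For non-zero $P,Q\in\mathbb{Q}[x]$, $\mathrm{Res}(P,Q)$ is the determinant of the Sylvester matrix of $P,Q$; equivalently, if $P$ has degree $n$, leading coefficient $a_n$ and complex roots $x_1,\dots,x_n$ (with multiplicity), then $\mathrm{Res}(P,Q)=a_n^{\deg Q}\prod_{i=1}^n Q(x_i)$. In particular $\mathrm{Res}(k,f)=\mathrm{Res}(f,k)=k^{\deg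 f}$ for a non-zero constant $k$. For $P$ of degree $n\ge1$ with leading coefficient $a_n$, $\mathrm{Disc}(P)=(-1)^{n(n-1)/2}a_n^{-1}\,\mathrm{Res}(P,P')$. Since $\deg(d)=1$, $d'$ is a constant. *)

theory Defs
  imports
    Subresultants.Resultant_Prelim
    "HOL-Computational_Algebra.Polynomial_Factorial"
    "HOL-Computational_Algebra.Field_as_Ring"
begin

fun lucas_seq :: "int \<Rightarrow> rat poly \<Rightarrow> rat poly \<Rightarrow> rat poly \<Rightarrow> nat \<Rightarrow> rat poly" where
  "lucas_seq p0 p1 d g 0 = [:of_int p0:]"
| "lucas_seq p0 p1 d g (Suc 0) = p1"
| "lucas_seq p0 p1 d g (Suc (Suc n)) =
     d * lucas_seq p0 p1 d g (Suc n) + g * lucas_seq p0 p1 d g n"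

(* All gcds are taken in Q[x], where gcd is normalised to be monic; hence the three
   conditions involving the non-zero constant p0 are automatic there. *)
definition lucas_type_data ::
  "int \<Rightarrow> rat poly \<Rightarrow> rat poly \<Rightarrow> rat poly \<Rightarrow> int \<Rightarrow> bool" where
  "lucas_type_data p0 p1 d g \<alpha> \<longleftrightarrow>
     \<bar>p0\<bar> \<in> {1, 2} \<and>
     (of_int \<alpha> :: rat) = 2 / of_int p0 \<and>
     p1 \<noteq> 0 \<and> d \<noteq> 0 \<and> g \<noteq> 0 \<and>
     d = smult (of_int \<alpha>) p1 \<and>
     gcd d g = 1 \<and>
     degree g < degree d \<and>
     gcd [:of_int p0:] p1 = 1 \<and> gcd [:of_int p0:] d = 1 \<and> gcd [:of_int p0:] g = 1 \<and>
     degree (lucas_seq p0 p1 d g 1) \<ge> 1"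

(* Intended for degree P >= 1 only; Res is the determinant of the Sylvester matrix. *)
definition disc :: "'a::field poly \<Rightarrow> 'a" where
  "disc P = (- 1) ^ (degree P * (degree P - 1) div 2) * inverse (lead_coeff P)
              * resultant P (pderiv P)"

end

theory Submission
  imports Defs Subresultants.Subresultant
begin

text \<open>
  Up to the constant factor \<open>1/\<alpha>\<close>, \<open>L n\<close> is the companion Lucas polynomial \<open>V n\<close>, and
  \<open>V' n = n d' U n\<close> for the Lucas polynomials \<open>U\<close> of the first kind. Since
  \<open>V (n + 1) = d * U (n + 1) + 2 g * U n\<close> and \<open>U (n + 2) = d * U (n + 1) + g * U n\<close> are steps of the
  Euclidean algorithm with constant factors on the remainders, \<open>Res (V n, U n)\<close> is a product of
  leading coefficients and powers of \<open>g\<close> and \<open>2\<close>.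
\<close>

fun lucas_U :: "'a::comm_ring_1 poly \<Rightarrow> 'a \<Rightarrow> nat \<Rightarrow> 'a poly" where
  "lucas_U d c 0 = 0"
| "lucas_U d c (Suc 0) = 1"
| "lucas_U d c (Suc (Suc n)) = d * lucas_U d c (Suc n) + smult c (lucas_U d c n)"

fun lucas_V :: "'a::comm_ring_1 poly \<Rightarrow> 'a \<Rightarrow> nat \<Rightarrow> 'a poly" where
  "lucas_V d c 0 = [:2:]"
| "lucas_V d c (Suc 0) = d"
| "lucas_V d c (Suc (Suc n)) = d * lucas_V d c (Suc n) + smult c (lucas_V d c n)"

text \<open>The resultant is the subresultant of index 0, so this is the remainder rule for
  subresultants at that index. \<open>BT_lemma_1_12\<close> needs the index below
  \<open>degree H\<close>; a constant remainder is left to \<open>BT_lemma_1_13\<close>.\<close>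

lemma resultant_euclid_step:
  fixes F G H B :: "'a::idom poly"
  assumes "F = B * G + H" and "degree G \<le> degree F" and "degree H < degree G"
  shows "resultant F G =
    (-1) ^ (degree F * degree G) * lead_coeff G ^ (degree F - degree H) * resultant G H"
proof -
  have eq: "F + (- B) * G = H"
    using assms(1) by simp
  show ?thesis
  proof (cases "degree H = 0")
    case False
    then show ?thesis
      using BT_lemma_1_12[OF eq assms(2), of 0] assms(3)
      by (simp add: coeff_subresultant_0_0_resultant[symmetric])
  next
    case True
    then obtain h where H: "H = [:h:]"
      by (rule degree_eq_zeroE)
    \<comment> \<open>The right side is \<open>resultant G [:h:]\<close>; the exponents match
      because \<open>degree G\<close> is positive.\<close>
    have "h * h ^ (degree G - 1) = h ^ degree G"
      using assms(3) by (cases "degree G") auto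
    moreover have "subresultant 0 F G = smult
       ((-1) ^ (degree F * degree G) * lead_coeff G ^ degree F * h ^ (degree G - 1)) [:h:]"
      using BT_lemma_1_13[OF eq assms(2)] assms(3) H by simp
    ultimately show ?thesis
      unfolding coeff_subresultant_0_0_resultant[symmetric, of F G]
      by (simp add: H mult.assoc mult.commute[of _ h])
  qed
qed

lemma
  fixes d :: "'a::idom poly"
  assumes "degree d = 1"
  shows degree_lucas_U: "degree (lucas_U d c (Suc n)) = n"
    and lead_coeff_lucas_U: "lead_coeff (lucas_U d c (Suc n)) = lead_coeff d ^ n"
proof -
  have "degree (lucas_U d c (Suc n)) = n \<and>
      lead_coeff (lucas_U d c (Suc n)) = lead_coeff d ^ n"
  proof (induction n rule: induct_nat_012)
    case (ge2 n)
    have nz: "d \<noteq> 0" "lucas_U d c (Suc (Suc n)) \<noteq> 0"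
      using assms ge2.IH(2) by (metis degree_0 zero_neq_one, metis degree_0 nat.distinct(1))
    then have deg: "degree (d * lucas_U d c (Suc (Suc n))) = Suc (Suc n)"
      using assms ge2.IH(2) by (simp add: degree_mult_eq del: lucas_U.simps)
    have less: "degree (smult c (lucas_U d c (Suc n))) < degree (d * lucas_U d c (Suc (Suc n)))"
      using deg degree_smult_le[of c "lucas_U d c (Suc n)"] ge2.IH(1) by linarith
    have "degree (lucas_U d c (Suc (Suc (Suc n)))) = Suc (Suc n)"
      unfolding lucas_U.simps(3)[of d c "Suc n"] using degree_add_eq_left[OF less] deg by simp
    moreover have "lead_coeff (lucas_U d c (Suc (Suc (Suc n)))) = lead_coeff d ^ Suc (Suc n)"
      unfolding lucas_U.simps(3)[of d c "Suc n"] using lead_coeff_add_le[OF less]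
      by (simp only: add.commute[of "d * _"] lead_coeff_mult ge2.IH(2)[THEN conjunct2] power_Suc)
    ultimately show ?case by blast
  qed (use assms in simp_all)
  then show "degree (lucas_U d c (Suc n)) = n"
    and "lead_coeff (lucas_U d c (Suc n)) = lead_coeff d ^ n"
    by blast+
qed

text \<open>Both sides satisfy the same second-order recurrence, so agreement at two consecutive
  indices suffices.\<close>

lemma lucas_V_Suc:
  "lucas_V d c (Suc n) = d * lucas_U d c (Suc n) + smult (2 * c) (lucas_U d c n)"
proof (induction n rule: induct_nat_012)
  case (ge2 n)
  show ?case
    unfolding lucas_V.simps(3)[of d c "Suc n"] ge2.IH
    by (simp add: algebra_simps smult_add_right)
qed (simp_all add: numeral_poly algebra_simps)

text \<open>Differentiating the recurrence leaves the extra term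
  \<open>smult d' (lucas_V d c (Suc n))\<close>; expanding it by \<open>lucas_V_Suc\<close> raises
  the coefficients \<open>n + 1\<close> and \<open>n\<close> both to \<open>n + 2\<close>.\<close>

lemma pderiv_lucas_V:
  assumes "pderiv d = [:d':]"
  shows "pderiv (lucas_V d c n) = smult (of_nat n * d') (lucas_U d c n)"
proof (induction n rule: induct_nat_012)
  case (ge2 n)
  have "pderiv (lucas_V d c (Suc (Suc n))) =
      smult d' (lucas_V d c (Suc n)) + d * smult (of_nat (Suc n) * d') (lucas_U d c (Suc n))
       + smult c (smult (of_nat n * d') (lucas_U d c n))"
    by (simp add: pderiv_add pderiv_mult pderiv_smult assms ge2.IH)
  also have "\<dots> = smult (of_nat (Suc (Suc n)) * d') (lucas_U d c (Suc (Suc n)))"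
    unfolding lucas_V_Suc lucas_U.simps
    by (rule poly_eqI) (simp add: algebra_simps)
  finally show ?case .
qed (simp_all add: pderiv_pCons assms)

lemma resultant_lucas_U:
  fixes d :: "'a::idom poly"
  assumes "degree d = 1" and "c \<noteq> 0"
  shows "resultant (lucas_U d c (Suc (Suc n))) (lucas_U d c (Suc n)) =
    lead_coeff d ^ (n * (n + 1)) * c ^ (n * (n + 1) div 2)"
proof (induction n)
  case 0
  show ?case by simp
next
  case (Suc n)
  let ?b = "lead_coeff d" and ?U = "lucas_U d c"
  \<comment> \<open>The degrees of dividend and remainder differ by 2, hence the square. Extracting
    \<open>c\<close> from the second argument raises it to the degree \<open>Suc n\<close> of the
    first.\<close>
  have "resultant (?U (Suc (Suc (Suc n)))) (?U (Suc (Suc n))) =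
      (-1) ^ (Suc (Suc n) * Suc n) * (?b ^ Suc n) ^ 2 * (c ^ Suc n * resultant (?U (Suc (Suc n))) (?U (Suc n)))"
    using assms(2)
    by (subst resultant_euclid_step[OF lucas_U.simps(3)[of d c "Suc n"]];
        (unfold lead_coeff_lucas_U[OF assms(1)])?)
      (simp_all add: degree_lucas_U[OF assms(1)] resultant_smult_right
        del: lucas_U.simps power_Suc)
  also have "(-1) ^ (Suc (Suc n) * Suc n) = (1::'a)"
    by (rule neg_one_even_power) simp
  also have "(?b ^ Suc n) ^ 2 = ?b ^ (2 * Suc n)"
    by (simp only: power_mult[symmetric] mult.commute)
  also have "1 * ?b ^ (2 * Suc n) * (c ^ Suc n * resultant (?U (Suc (Suc n))) (?U (Suc n)))
      = ?b ^ (2 * Suc n + n * (n + 1)) * c ^ (Suc n + n * (n + 1) div 2)"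
    unfolding Suc.IH power_add by (simp only: ac_simps mult_1)
  also have "2 * Suc n + n * (n + 1) = Suc n * (Suc n + 1)"
    by simp
  also have "Suc n + n * (n + 1) div 2 = Suc n * (Suc n + 1) div 2"
    by simp
  finally show ?case .
qed

lemma
  fixes d :: "'a::idom poly"
  assumes "degree d = 1"
  shows degree_lucas_V: "degree (lucas_V d c (Suc n)) = Suc n"
    and lead_coeff_lucas_V: "lead_coeff (lucas_V d c (Suc n)) = lead_coeff d ^ Suc n"
proof -
  have deg: "degree (d * lucas_U d c (Suc n)) = Suc n"
    using assms degree_lucas_U[OF assms, of c n] lead_coeff_lucas_U[OF assms, of c n]
    by (subst degree_mult_eq) (auto simp del: lucas_U.simps)
  \<comment> \<open>Only a bound: \<open>2 * c\<close> may vanish here, and for \<open>n = 0\<close>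
    the polynomial is zero.\<close>
  have "degree (smult (2 * c) (lucas_U d c n)) \<le> n"
    using degree_lucas_U[OF assms, of c] degree_smult_le[of "2 * c" "lucas_U d c n"]
    by (cases n) (auto simp del: lucas_U.simps(3) intro: order_trans)
  then have less: "degree (smult (2 * c) (lucas_U d c n)) < degree (d * lucas_U d c (Suc n))"
    using deg by simp
  show "degree (lucas_V d c (Suc n)) = Suc n"
    unfolding lucas_V_Suc using degree_add_eq_left[OF less] deg by simp
  show "lead_coeff (lucas_V d c (Suc n)) = lead_coeff d ^ Suc n"
    unfolding lucas_V_Suc using lead_coeff_add_le[OF less]
    by (simp only: add.commute[of "d * _"] lead_coeff_mult lead_coeff_lucas_U[OF assms] power_Suc)
qed

text \<open>A single Euclidean step reduces this to consecutive \<open>lucas_U\<close>;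
  characteristic 0 ensures that the factor \<open>2 * c\<close> of the remainder is
  non-zero.\<close>

lemma resultant_lucas_V_U:
  fixes d :: "'a::{idom,ring_char_0} poly"
  assumes "degree d = 1" and "c \<noteq> 0"
  shows "resultant (lucas_V d c (Suc n)) (lucas_U d c (Suc n)) =
    lead_coeff d ^ (n * (n + 1)) * 2 ^ n * c ^ (n * (n + 1) div 2)"
\<comment> \<open>For \<open>n = 0\<close> the divisor is the constant 1, and no remainder has
  smaller degree.\<close>
proof (cases n)
  case 0
  then show ?thesis by simp
next
  case (Suc m)
  let ?b = "lead_coeff d" and ?U = "lucas_U d c"
  have "resultant (lucas_V d c (Suc n)) (?U (Suc n)) =
      (-1) ^ (Suc (Suc m) * Suc m) * (?b ^ Suc m) ^ 2 * ((2 * c) ^ Suc m * resultant (?U (Suc (Suc m))) (?U (Suc m)))"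
    unfolding Suc using assms(2)
    by (subst resultant_euclid_step[OF lucas_V_Suc[of d c "Suc m"]];
        (unfold lead_coeff_lucas_U[OF assms(1)])?)
      (simp_all add: degree_lucas_U[OF assms(1)] degree_lucas_V[OF assms(1)] resultant_smult_right
        del: lucas_U.simps lucas_V.simps power_Suc)
  also have "(-1) ^ (Suc (Suc m) * Suc m) = (1::'a)"
    by (rule neg_one_even_power) simp
  also have "(?b ^ Suc m) ^ 2 = ?b ^ (2 * Suc m)"
    by (simp only: power_mult[symmetric] mult.commute)
  also have "1 * ?b ^ (2 * Suc m) * ((2 * c) ^ Suc m * resultant (?U (Suc (Suc m))) (?U (Suc m)))
      = ?b ^ (2 * Suc m + m * (m + 1)) * 2 ^ Suc m * c ^ (Suc m + m * (m + 1) div 2)"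
    unfolding resultant_lucas_U[OF assms] power_add power_mult_distrib by (simp only: ac_simps mult_1)
  also have "2 * Suc m + m * (m + 1) = n * (n + 1)"
    by (simp add: Suc)
  also have "Suc m + m * (m + 1) div 2 = n * (n + 1) div 2"
    by (simp add: Suc)
  finally show ?thesis by (simp add: Suc)
qed

text \<open>The sign exponent of the discriminant equals the exponent of \<open>c\<close> in the
  resultant, so the two merge into a power of \<open>- c\<close>. The powers of
  \<open>lead_coeff d\<close> stay a quotient because their total exponent is -1 for
  \<open>n = 0\<close>.\<close>

lemma disc_lucas_V:
  fixes d :: "'a::field_char_0 poly"
  assumes "degree d = 1" and "c \<noteq> 0" and "pderiv d = [:d':]"
  shows "disc (lucas_V d c (Suc n)) =
    (- c) ^ (n * (n + 1) div 2) * 2 ^ n * (of_nat (Suc n) * d') ^ Suc n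
      * (lead_coeff d ^ (n * (n + 1)) / lead_coeff d ^ Suc n)"
proof -
  have "d' \<noteq> 0"
    using assms(1,3) pderiv_eq_0_iff[of d] by auto
  then have nz: "of_nat (Suc n) * d' \<noteq> 0"
    by (metis mult_eq_0_iff of_nat_eq_0_iff nat.distinct(1))
  have sgn: "(- c) ^ k = (- 1) ^ k * c ^ k" for k
    by (metis mult_minus1 power_mult_distrib)
  show ?thesis
    unfolding disc_def pderiv_lucas_V[OF assms(3)] lead_coeff_lucas_V[OF assms(1)]
    unfolding degree_lucas_V[OF assms(1)]
      resultant_smult_right[OF nz] resultant_lucas_V_U[OF assms(1,2)] sgn
    by (simp add: field_simps del: of_nat_Suc power_Suc)
qed

text \<open>The two arguments of the resultant contribute \<open>degree P - 1\<close> and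
  \<open>degree P\<close> factors \<open>k\<close>; the inverse leading coefficient removes
  one.\<close>

lemma disc_smult:
  fixes P :: "'a::field_char_0 poly"
  assumes "k \<noteq> 0" and "degree P \<ge> 1"
  shows "disc (smult k P) = k ^ (2 * (degree P - 1)) * disc P"
proof -
  obtain m where m: "degree P = Suc m"
    using assms(2) by (cases "degree P") auto
  then show ?thesis
    using assms(1)
    by (simp add: disc_def pderiv_smult resultant_smult_left resultant_smult_right degree_pderiv
        power_add mult_2_right field_simps)
qed

text \<open>The recurrence is linear, so scaling both initial values of \<open>lucas_V\<close> by
  \<open>k\<close> scales the whole sequence.\<close>

lemma lucas_seq_eq_smult_lucas_V:
  assumes "of_int p0 = 2 * k" and "p1 = smult k d"
  shows "lucas_seq p0 p1 d [:c:] n = smult k (lucas_V d c n)"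
  by (induction n rule: induct_nat_012)
    (simp_all add: assms mult.commute[of 2] smult_add_right ac_simps)

theorem theorem5:
  fixes p0 \<alpha> :: int and p1 d g :: "rat poly" and \<beta> \<rho> d' :: rat and n :: nat
  assumes "lucas_type_data p0 p1 d g \<alpha>"
    and "degree d = 1"
    and "degree g = 0"
    and "\<beta> = lead_coeff d"
    and "\<rho> = resultant g d"
    and "pderiv d = [:d':]"
    and "n \<ge> 1"
  shows "disc (lucas_seq p0 p1 d g n) =
           (- \<rho>) ^ (n * (n - 1) div 2) * 2 ^ (n - 1) * (of_nat n * d') ^ n
             * of_int \<alpha> powi (2 - 2 * int n) * \<beta> powi (int n * (int n - 2))"
proof -
  obtain m where n: "n = Suc m"
    using assms(7) by (cases n) auto
  obtain c where g: "g = [:c:]"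
    using assms(3) by (rule degree_eq_zeroE)
  have c: "c \<noteq> 0" and p0: "p0 \<noteq> 0" and \<alpha>: "(of_int \<alpha> :: rat) = 2 / of_int p0"
    and d: "d = smult (of_int \<alpha>) p1"
    using assms(1) by (auto simp: lucas_type_data_def g)
  \<comment> \<open>Since \<alpha> is \<open>2 / p0\<close> and \<open>d\<close> is \<alpha> times
    \<open>p1\<close>, this \<open>k\<close> gives both \<open>p0 = 2 * k\<close> and
    \<open>p1 = smult k d\<close>.\<close>
  define k where "k = 1 / (of_int \<alpha> :: rat)"
  have \<alpha>0: "(of_int \<alpha> :: rat) \<noteq> 0"
    using \<alpha> p0 by simp
  have k0: "k \<noteq> 0"
    using \<alpha>0 by (simp add: k_def)
  have L: "lucas_seq p0 p1 d g n = smult k (lucas_V d c n)"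
    unfolding g by (rule lucas_seq_eq_smult_lucas_V) (use \<alpha> p0 \<alpha>0 in \<open>simp_all add: k_def d\<close>)
  have \<rho>: "\<rho> = c"
    by (simp add: assms(2,5) g)
  have \<beta>0: "\<beta> \<noteq> 0"
    using assms(2,4) leading_coeff_neq_0[of d] by force
  have "k ^ (2 * m) = of_int \<alpha> powi (2 - 2 * int n)"
    using \<alpha>0 by (simp add: n k_def power_int_def power_one_over nat_mult_distrib field_simps)
  \<comment> \<open>With \<open>n = m + 1\<close> the exponent is \<open>(m + 1) * (m - 1)\<close>,
    negative when \<open>n = 1\<close>; hence the passage to integer powers.\<close>
  moreover have "\<beta> ^ (m * (m + 1)) / \<beta> ^ Suc m = \<beta> powi (int n * (int n - 2))"
  proof -
    have "\<beta> ^ (m * (m + 1)) / \<beta> ^ Suc m = \<beta> powi (int (m * (m + 1)) - int (Suc m))"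
      unfolding power_int_diff[OF disjI1[OF \<beta>0]] power_int_of_nat ..
    also have "int (m * (m + 1)) - int (Suc m) = int n * (int n - 2)"
      by (simp add: n algebra_simps)
    finally show ?thesis .
  qed
  moreover have "disc (lucas_seq p0 p1 d g n) = k ^ (2 * m) * disc (lucas_V d c n)"
    unfolding L unfolding n using disc_smult[OF k0, of "lucas_V d c (Suc m)"] degree_lucas_V[OF assms(2)]
    by simp
  ultimately show ?thesis
    using disc_lucas_V[OF assms(2) c assms(6), of m]
    by (simp add: n \<rho> assms(4)[symmetric] mult_ac del: of_nat_Suc power_Suc)
qed

end
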